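(* For every integer $n\ge1$, the poset $\mathcal{D}(n)$ of hyperbinary expansions of $n$ (equivalently, the poset of hyperbinary partitions of $n$ ordered by refinement) is isomorphic to the lattice $\mathcal{J}(\mathcal{F}(n))$ of lower order ideals of the fence $\mathcal{F}(n)$ ordered by inclusion.
   Context: A hyperbinary partition of $n$ is a partition of $n$ into powers of $2$ in which each part occurs at most twice. Refinement order: $\mu\le\lambda$ if the parts of $\lambda$ can be subdivided to produce the parts of $\mu$. Let $\beta(n)=b_1b_2\cdots b_k$ be the binary expansion of $n$ with $b_1=1$ the most significant digit, so $n=\sum_i b_i2^{k-i}$. A hyperbinary expansion of $n$ is a word $d=d_1\cdots d_k$ of the same length $k$ with $d_i\in\{0,1,2\}$ and $\sum_i d_i2^{k-i}=n$; it corresponds bijectively to the hyperbinary partition in which $2^{k-i}$ has multiplicity $d_i$. $\mathcal{D}(n)$ is the set of hyperbinary expansions of $n$ with the order transported from refinement of the corresponding partitions. The principal prefix of $\beta(n)$ is $b_1\cdots b_r$, where $b_{r+1}$ is the rightmost $0$ of $\beta(n)$ (if $\beta(n)$ has no $0$, the principal prefix is empty and $r=0$). The fence $\mathcal{F}(n)$ is the poset on $\{x_1,\dots,x_r\}$ whose cover relations are, for $2\le i\le r$: $x_i$ is covered by $x_{i-1}$ if $b_i=0$, and $x_i$ covers $x_{i-1}$ if $b_i=1$ (no other covers). *)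

theory Defs
  imports "HOL-Library.Multiset"
begin

definition order_isomorphic ::
  "'a set \<Rightarrow> ('a \<Rightarrow> 'a \<Rightarrow> bool) \<Rightarrow> 'b set \<Rightarrow> ('b \<Rightarrow> 'b \<Rightarrow> bool) \<Rightarrow> bool" where
  "order_isomorphic A leA B leB \<longleftrightarrow>
     (\<exists>f. bij_betw f A B \<and> (\<forall>x\<in>A. \<forall>y\<in>A. leA x y \<longleftrightarrow> leB (f x) (f y)))"

definition hyperbinary_partitions :: "nat \<Rightarrow> nat multiset set" where
  "hyperbinary_partitions n =
     {M. sum_mset M = n \<and> (\<forall>p\<in>#M. \<exists>j. p = 2 ^ j) \<and> (\<forall>p. count M p \<le> 2)}"

text \<open>\<open>refines M L\<close> is \<open>M \<le> L\<close> in the refinement order: each block \<open>B\<close> in \<open>P\<close>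
  subdivides the part \<open>sum_mset B\<close> of \<open>L\<close>. When all parts of \<open>L\<close> are positive,
  no block is empty.\<close>

definition refines :: "nat multiset \<Rightarrow> nat multiset \<Rightarrow> bool" where
  "refines M L \<longleftrightarrow> (\<exists>P. \<Sum>\<^sub># P = M \<and> image_mset sum_mset P = L)"

text \<open>Words are lists with the most significant digit first; \<open>digit d i\<close> is the
  letter \<open>d\<^sub>i\<close> of the word, with \<open>1 \<le> i \<le> length d\<close>.\<close>

definition digit :: "nat list \<Rightarrow> nat \<Rightarrow> nat" where
  "digit d i = d ! (i - 1)"

definition word_value :: "nat list \<Rightarrow> nat" where
  "word_value d = (\<Sum>i=1..length d. digit d i * 2 ^ (length d - i))"

fun binary_expansion :: "nat \<Rightarrow> nat list" where
  "binary_expansion n = (if n = 0 then [] else binary_expansion (n div 2) @ [n mod 2])"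

declare binary_expansion.simps [simp del]

definition hyperbinary_expansions :: "nat \<Rightarrow> nat list set" where
  "hyperbinary_expansions n =
     {d. length d = length (binary_expansion n) \<and> set d \<subseteq> {0, 1, 2} \<and> word_value d = n}"

definition partition_of_word :: "nat list \<Rightarrow> nat multiset" where
  "partition_of_word d = (\<Sum>i=1..length d. replicate_mset (digit d i) (2 ^ (length d - i)))"

definition expansion_le :: "nat list \<Rightarrow> nat list \<Rightarrow> bool" where
  "expansion_le d e \<longleftrightarrow> refines (partition_of_word d) (partition_of_word e)"

definition principal_prefix_length :: "nat \<Rightarrow> nat" where
  "principal_prefix_length n =
     (let b = binary_expansion n; Z = {j \<in> {1..length b}. digit b j = 0}
      in if Z = {} then 0 else Max Z - 1)"

text \<open>The element \<open>x\<^sub>i\<close> of the fence is represented by its index \<open>i\<close>.\<close>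

definition fence_carrier :: "nat \<Rightarrow> nat set" where
  "fence_carrier n = {1..principal_prefix_length n}"

text \<open>A pair \<open>(x, y)\<close> in \<open>fence_covers n\<close> means that \<open>x\<close> is covered by \<open>y\<close>.\<close>

definition fence_covers :: "nat \<Rightarrow> (nat \<times> nat) set" where
  "fence_covers n =
     {(i, i - 1) |i. i \<in> {2..principal_prefix_length n} \<and> digit (binary_expansion n) i = 0} \<union>
     {(i - 1, i) |i. i \<in> {2..principal_prefix_length n} \<and> digit (binary_expansion n) i = 1}"

definition fence_le :: "nat \<Rightarrow> nat \<Rightarrow> nat \<Rightarrow> bool" where
  "fence_le n x y \<longleftrightarrow> (x, y) \<in> (fence_covers n)\<^sup>*"

definition lower_order_ideals :: "'a set \<Rightarrow> ('a \<Rightarrow> 'a \<Rightarrow> bool) \<Rightarrow> 'a set set" where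
  "lower_order_ideals A le = {I. I \<subseteq> A \<and> (\<forall>y\<in>I. \<forall>x\<in>A. le x y \<longrightarrow> x \<in> I)}"

lemma word_value_snoc: "word_value (d @ [a]) = 2 * word_value d + a"
proof -
  have "(\<Sum>i=1..length d. digit (d @ [a]) i * 2 ^ (Suc (length d) - i))
      = (\<Sum>i=1..length d. 2 * (digit d i * 2 ^ (length d - i)))"
    by (rule sum.cong) (auto simp: digit_def nth_append Suc_diff_le)
  then show ?thesis
    by (simp add: word_value_def digit_def sum_distrib_left)
qed

lemma binary_expansion_correct:
  "word_value (binary_expansion n) = n"
  "set (binary_expansion n) \<subseteq> {0, 1}"
  "n \<ge> 1 \<Longrightarrow> binary_expansion n \<noteq> [] \<and> hd (binary_expansion n) = 1"
proof (induction n rule: less_induct)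
  case (less n)
  note unf = binary_expansion.simps[of n]
  { case 1
    show ?case
    proof (cases "n = 0")
      case True
      then show ?thesis by (simp add: binary_expansion.simps[of 0] word_value_def)
    next
      case False
      then show ?thesis using less(1)[of "n div 2"] by (simp add: unf word_value_snoc)
    qed
  next
    case 2
    show ?case
      using less(2)[of "n div 2"] by (auto simp: unf)
  next
    case 3
    show ?case
    proof (cases "n = 1")
      case True
      then show ?thesis by (simp add: binary_expansion.simps[of 0] binary_expansion.simps[of "Suc 0"])
    next
      case False
      with 3 have "n div 2 \<ge> 1" "n div 2 < n" by auto
      with less(3)[of "n div 2"] 3 show ?thesis by (simp add: unf hd_append)
    qed
  }
qed

end

theory Submission
  imports Defs
begin

text \<open>Write \<open>V\<^sub>i(d)\<close> for the value of the prefix \<open>d\<^sub>1 \<dots> d\<^sub>i\<close>. For a hyperbinary expansion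
  \<open>d\<close> of \<open>n\<close> with binary expansion \<open>b\<close>, the borrow \<open>c\<^sub>i = V\<^sub>i(b) - V\<^sub>i(d)\<close> is \<open>0\<close> or \<open>1\<close> and
  \<open>d\<^sub>i = b\<^sub>i + 2 c\<^sub>i\<^sub>-\<^sub>1 - c\<^sub>i\<close>. Then \<open>0 \<le> d\<^sub>i \<le> 2\<close> says exactly that \<open>c\<^sub>i \<le> c\<^sub>i\<^sub>-\<^sub>1\<close> if
  \<open>b\<^sub>i = 0\<close> and \<open>c\<^sub>i\<^sub>-\<^sub>1 \<le> c\<^sub>i\<close> if \<open>b\<^sub>i = 1\<close>, so (as \<open>c\<close> vanishes beyond the principal prefix) the
  indices without a borrow form an arbitrary lower ideal of the fence. On the other side, for
  partitions \<open>M\<close>, \<open>L\<close> of the same number into powers of two, \<open>M\<close> refines \<open>L\<close> if and only if for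
  each \<open>j\<close> the parts that are at least \<open>2\<^sup>j\<close> have no larger sum in \<open>M\<close> than in \<open>L\<close>. For words this
  compares the values \<open>V\<^sub>i\<close>, hence the sets of indices without a borrow.\<close>

section \<open>Symmetry and transitivity of order isomorphism\<close>

lemma order_isomorphic_sym:
  assumes "order_isomorphic A leA B leB"
  shows "order_isomorphic B leB A leA"
proof -
  obtain f where f: "bij_betw f A B" "\<forall>x\<in>A. \<forall>y\<in>A. leA x y \<longleftrightarrow> leB (f x) (f y)"
    using assms by (auto simp: order_isomorphic_def)
  let ?g = "inv_into A f"
  have "bij_betw ?g B A"
    using f(1) by (rule bij_betw_inv_into)
  moreover have "?g x \<in> A \<and> f (?g x) = x" if "x \<in> B" for x
    using f(1) that by (metis bij_betw_def f_inv_into_f inv_into_into)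
  ultimately show ?thesis
    using f(2) unfolding order_isomorphic_def by metis
qed

lemma order_isomorphic_trans:
  assumes "order_isomorphic A leA B leB" "order_isomorphic B leB C leC"
  shows "order_isomorphic A leA C leC"
proof -
  obtain f where f: "bij_betw f A B" "\<forall>x\<in>A. \<forall>y\<in>A. leA x y \<longleftrightarrow> leB (f x) (f y)"
    using assms(1) by (auto simp: order_isomorphic_def)
  obtain g where g: "bij_betw g B C" "\<forall>x\<in>B. \<forall>y\<in>B. leB x y \<longleftrightarrow> leC (g x) (g y)"
    using assms(2) by (auto simp: order_isomorphic_def)
  have "bij_betw (g \<circ> f) A C"
    using f(1) g(1) by (rule bij_betw_trans)
  moreover have "f x \<in> B" if "x \<in> A" for x
    using f(1) that by (rule bij_betw_apply)
  ultimately show ?thesis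
    using f(2) g(2) unfolding order_isomorphic_def by (intro exI[of _ "g \<circ> f"]) simp
qed

section \<open>Refinement of partitions into powers of two\<close>

text \<open>The threshold is not restricted to powers of two, so that the copies of a part
  \<open>m\<close> can be separated from the parts above it by passing from \<open>m\<close> to
  \<open>Suc m\<close>.\<close>

definition large_sum :: "nat \<Rightarrow> nat multiset \<Rightarrow> nat" where
  "large_sum t M = \<Sum>\<^sub># (filter_mset (\<lambda>p. t \<le> p) M)"

lemma large_sum_empty [simp]: "large_sum t {#} = 0"
  by (simp add: large_sum_def)

lemma large_sum_add_mset [simp]:
  "large_sum t (add_mset p M) = (if t \<le> p then p else 0) + large_sum t M"
  by (simp add: large_sum_def)

lemma large_sum_union [simp]: "large_sum t (M + N) = large_sum t M + large_sum t N"
  by (simp add: large_sum_def)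

lemma large_sum_le_sum_mset: "large_sum t M \<le> \<Sum>\<^sub># M"
  by (induction M) auto

lemma large_sum_eq_0:
  assumes "\<Sum>\<^sub># M < t"
  shows "large_sum t M = 0"
  using assms by (induction M) auto

text \<open>A block contributes at most the part it subdivides. If that part is below
  \<open>t\<close>, so are all members of the block, and both contributions vanish.\<close>

lemma refines_imp_large_sum_le:
  assumes "refines M L"
  shows "large_sum t M \<le> large_sum t L"
proof -
  obtain P where P: "\<Sum>\<^sub># P = M" "image_mset sum_mset P = L"
    using assms by (auto simp: refines_def)
  have "large_sum t (\<Sum>\<^sub># P) \<le> large_sum t (image_mset sum_mset P)"
  proof (induction P)
    case (add B P)
    then show ?case
      using large_sum_le_sum_mset[of t B] large_sum_eq_0[of B t] by auto
  qed simp
  with P show ?thesis by simp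
qed

lemma refines_refl: "refines M M"
  unfolding refines_def
  by (rule exI[of _ "image_mset (\<lambda>p. {#p#}) M"]) (simp add: multiset.map_comp comp_def)

text \<open>The blocks subdividing \<open>p\<close> and \<open>q\<close> unite to one block
  subdividing \<open>p + q\<close>. This undoes a halving.\<close>

lemma refines_merge:
  assumes "refines M (add_mset p (add_mset q L))"
  shows "refines M (add_mset (p + q) L)"
proof -
  obtain P where P: "\<Sum>\<^sub># P = M" "image_mset sum_mset P = add_mset p (add_mset q L)"
    using assms by (auto simp: refines_def)
  obtain B P1 where B: "P = add_mset B P1" "sum_mset B = p" "image_mset sum_mset P1 = add_mset q L"
    using msed_map_invR[OF P(2)] by auto
  obtain C P2 where C: "P1 = add_mset C P2" "sum_mset C = q" "image_mset sum_mset P2 = L"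
    using msed_map_invR[OF B(3)] by auto
  show ?thesis
    unfolding refines_def using P(1) B C
    by (intro exI[of _ "add_mset (B + C) P2"]) (simp add: ac_simps)
qed

lemma large_sum_split:
  "large_sum t M = t * count M t + large_sum (Suc t) M"
  by (induction M) auto

text \<open>Halving one copy of the largest part \<open>2 ^ j\<close> whose multiplicities in \<open>M\<close> and \<open>L\<close> differ
  preserves the hypotheses and increases the size of \<open>L\<close>.\<close>

lemma large_sum_le_imp_refines:
  assumes "\<forall>p\<in>#M. \<exists>j. p = 2 ^ j" "\<forall>p\<in>#L. \<exists>j. p = 2 ^ j"
    and "\<Sum>\<^sub># M = \<Sum>\<^sub># L" "\<And>j. large_sum (2 ^ j) M \<le> large_sum (2 ^ j) L"
  shows "refines M L"
  using assms
proof (induction "\<Sum>\<^sub># L - size L" arbitrary: L rule: less_induct)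
  case less
  note pM = less.prems(1) and pL = less.prems(2) and tot = less.prems(3) and le = less.prems(4)
  show ?case
  proof (cases "M = L")
    case True
    then show ?thesis by (simp add: refines_refl)
  next
    case False
    let ?D = "{p. count M p \<noteq> count L p}"
    define m where "m = Max ?D"
    have sub: "?D \<subseteq> set_mset M \<union> set_mset L"
      by (auto simp: count_eq_zero_iff dest: not_in_iff[THEN iffD1])
    then have fin: "finite ?D"
      by (rule finite_subset) simp
    have "?D \<noteq> {}"
      using False by (auto intro: multiset_eqI)
    then have m: "m \<in> ?D" and mmax: "\<And>p. p \<in> ?D \<Longrightarrow> p \<le> m"
      using fin by (auto simp: m_def simp del: mem_Collect_eq)
    obtain j where j: "m = 2 ^ j"
      using m sub pM pL by blast
    have tail: "large_sum (Suc m) M = large_sum (Suc m) L"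
    proof -
      have "count M p = count L p" if "Suc m \<le> p" for p
        using mmax[of p] that by (cases "p \<in> ?D") auto
      then have "filter_mset (\<lambda>p. Suc m \<le> p) M = filter_mset (\<lambda>p. Suc m \<le> p) L"
        by (intro multiset_eqI) simp
      then show ?thesis by (simp add: large_sum_def)
    qed
    \<comment> \<open>Above \<open>m\<close> the multiplicities agree, so the hypothesis at
      threshold \<open>m\<close> compares only the copies of \<open>m\<close>.\<close>
    have "m * count M m \<le> m * count L m"
      using le[of j] tail by (simp add: j[symmetric] large_sum_split[of m])
    then have cnt: "count M m < count L m"
      using m j by auto
    have lt: "m + large_sum m M \<le> large_sum m L"
      using mult_le_mono2[of "Suc (count M m)" "count L m" m] cnt tail
      by (simp add: large_sum_split[of m])
    \<comment> \<open>For \<open>j = 0\<close> the sums in \<open>lt\<close> would be the full sums,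
      which are equal, while \<open>lt\<close> is a strict inequality.\<close>
    have "j \<noteq> 0"
    proof
      assume "j = 0"
      have "large_sum 1 N = \<Sum>\<^sub># N" for N :: "nat multiset"
        by (induction N) auto
      then show False
        using lt tot j \<open>j = 0\<close> by simp
    qed
    then obtain i where i: "j = Suc i" by (cases j) auto
    have "m \<in># L"
      using cnt by (simp flip: count_greater_zero_iff)
    then obtain K where K: "L = add_mset m K"
      by (rule mset_add)
    define L' where "L' = add_mset (2 ^ i) (add_mset (2 ^ i) K)"
    have "refines M L'"
    proof (rule less.hyps)
      \<comment> \<open>Parts are positive, so there are at most as many as their sum. Hence the
        subtraction in the measure is not truncated and the measure drops by one.\<close>
      have "size N \<le> \<Sum>\<^sub># N" if "\<forall>p\<in>#N. \<exists>j. p = 2 ^ j" for N :: "nat multiset"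
        using that
      proof (induction N)
        case (add p N)
        then have "1 \<le> p" by auto
        with add show ?case by auto
      qed simp
      then have "size K \<le> \<Sum>\<^sub># K" using pL K by simp
      moreover have "\<Sum>\<^sub># L' = \<Sum>\<^sub># L" "\<Sum>\<^sub># L = 2 * 2 ^ i + \<Sum>\<^sub># K"
        by (simp_all add: K L'_def j i)
      moreover have "size L' = Suc (size L)" "size L = Suc (size K)"
        by (simp_all add: K L'_def)
      moreover have "(1::nat) \<le> 2 ^ i" by (rule one_le_power) simp
      ultimately show "\<Sum>\<^sub># L' - size L' < \<Sum>\<^sub># L - size L"
        by linarith
      show "\<forall>p\<in>#M. \<exists>j. p = 2 ^ j" by (fact pM)
      show "\<forall>p\<in>#L'. \<exists>j. p = 2 ^ j" using pL by (auto simp: K L'_def)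
      show "\<Sum>\<^sub># M = \<Sum>\<^sub># L'" using tot by (simp add: K L'_def j i)
      fix l
      show "large_sum (2 ^ l) M \<le> large_sum (2 ^ l) L'"
      \<comment> \<open>Only the threshold \<open>2 ^ j\<close> separates \<open>m\<close> from its
        halves. There the large sum of \<open>L\<close> loses \<open>m\<close>, which
        \<open>lt\<close> allows; every other threshold counts both halves exactly when it counts
        \<open>m\<close>.\<close>
      proof (cases "l = j")
        case True
        have "(2::nat) ^ i < m" by (simp add: j i)
        then have "large_sum m L' = large_sum m K" "large_sum m L = m + large_sum m K"
          by (simp_all add: K L'_def)
        then show ?thesis using lt j True by simp
      next
        case False
        then have "l \<le> i \<longleftrightarrow> l \<le> Suc i" using i by auto
        then have "(2::nat) ^ l \<le> 2 ^ i \<longleftrightarrow> (2::nat) ^ l \<le> m"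
          unfolding j i by (simp only: power_increasing_iff one_less_numeral_iff semiring_norm)
        then have "large_sum (2 ^ l) L' = large_sum (2 ^ l) L"
          unfolding K L'_def large_sum_add_mset by (simp add: j i)
        then show ?thesis using le[of l] by simp
      qed
    qed
    then have "refines M (add_mset (2 ^ i + 2 ^ i) K)"
      unfolding L'_def by (rule refines_merge)
    then show ?thesis by (simp only: K j i power_Suc mult_2)
  qed
qed

section \<open>Words and partitions\<close>

lemma word_value_take_Suc:
  assumes "i < length d"
  shows "word_value (take (Suc i) d) = 2 * word_value (take i d) + digit d (Suc i)"
  using assms by (simp add: take_Suc_conv_app_nth word_value_snoc digit_def)

lemma word_value_take_0 [simp]: "word_value (take 0 d) = 0"
  by (simp add: word_value_def)

lemma sum_mset_partition_of_word: "\<Sum>\<^sub># (partition_of_word d) = word_value d"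
proof -
  have "\<Sum>\<^sub># (\<Sum>i\<in>A. replicate_mset (digit d i) (2 ^ (length d - i)))
      = (\<Sum>i\<in>A. digit d i * 2 ^ (length d - i))" if "finite A" for A
    using that by (induction A) auto
  then show ?thesis by (simp add: partition_of_word_def word_value_def)
qed

lemma partition_of_word_powers: "p \<in># partition_of_word d \<Longrightarrow> \<exists>j. p = 2 ^ j"
  by (auto simp: partition_of_word_def set_mset_sum split: if_splits)

text \<open>The parts that reach the threshold come from the first \<open>i\<close> letters, and
  each of their weights is \<open>2 ^ (length d - i)\<close> times its weight in the prefix.\<close>

lemma large_sum_partition_of_word:
  assumes "i \<le> length d"
  shows "large_sum (2 ^ (length d - i)) (partition_of_word d) =
    2 ^ (length d - i) * word_value (take i d)"
proof -
  let ?k = "length d"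
  have rep: "large_sum t (replicate_mset a p) = (if t \<le> p then a * p else 0)" for t a p
    by (induction a) auto
  have "large_sum t (\<Sum>l\<in>A. f l) = (\<Sum>l\<in>A. large_sum t (f l))"
    if "finite A" for A :: "nat set" and f t
    using that by (induction A) auto
  then have "large_sum (2 ^ (?k - i)) (partition_of_word d) =
      (\<Sum>l=1..?k. if ?k - i \<le> ?k - l then digit d l * 2 ^ (?k - l) else 0)"
    by (simp add: partition_of_word_def rep)
  also have "\<dots> = (\<Sum>l=1..i. digit d l * 2 ^ (?k - l))"
    using assms by (intro sum.mono_neutral_cong_right) auto
  also have "\<dots> = (\<Sum>l=1..i. 2 ^ (?k - i) * (digit d l * 2 ^ (i - l)))"
    using assms by (intro sum.cong) (auto simp flip: power_add)
  also have "\<dots> = 2 ^ (?k - i) * word_value (take i d)"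
    using assms by (auto simp: word_value_def sum_distrib_left digit_def min_def intro!: sum.cong)
  finally show ?thesis .
qed

lemma expansion_le_iff:
  assumes "length d = length e" "word_value d = word_value e"
  shows "expansion_le d e \<longleftrightarrow> (\<forall>i\<le>length d. word_value (take i d) \<le> word_value (take i e))"
    (is "_ \<longleftrightarrow> ?R")
proof
  assume "expansion_le d e"
  then have *: "large_sum t (partition_of_word d) \<le> large_sum t (partition_of_word e)" for t
    by (auto simp: expansion_le_def intro: refines_imp_large_sum_le)
  show ?R
  proof (intro allI impI)
    fix i assume "i \<le> length d"
    then show "word_value (take i d) \<le> word_value (take i e)"
      using *[of "2 ^ (length d - i)"] large_sum_partition_of_word[of i d]
        large_sum_partition_of_word[of i e] assms(1) by simp
  qed
next
  assume R: ?R
  show "expansion_le d e"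
    unfolding expansion_le_def
  proof (rule large_sum_le_imp_refines)
    fix j
    show "large_sum (2 ^ j) (partition_of_word d) \<le> large_sum (2 ^ j) (partition_of_word e)"
    \<comment> \<open>Thresholds up to \<open>2 ^ length d\<close> correspond to prefix lengths; a
      larger one exceeds every part of \<open>d\<close>.\<close>
    proof (cases "j \<le> length d")
      case True
      then show ?thesis
        using large_sum_partition_of_word[of "length d - j" d]
          large_sum_partition_of_word[of "length d - j" e] R assms(1) by simp
    next
      case False
      have "large_sum (2 ^ j) (partition_of_word d) = 0"
      proof -
        have "p < 2 ^ j" if p: "p \<in># partition_of_word d" for p
        proof -
          obtain i where "p = 2 ^ (length d - i)"
            using p by (auto simp: partition_of_word_def set_mset_sum split: if_splits)
          then show ?thesis using False by (auto intro: power_strict_increasing)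
        qed
        moreover have "large_sum t N = 0" if "\<forall>p\<in>#N. p < t" for t N
          using that by (induction N) auto
        ultimately show ?thesis by blast
      qed
      then show ?thesis by simp
    qed
  qed (use assms in \<open>auto simp: sum_mset_partition_of_word dest: partition_of_word_powers\<close>)
qed

text \<open>Distinct positions carry distinct powers, so the letters can be recovered as
  multiplicities. This serves both injectivity and surjectivity of
  \<open>partition_of_word\<close>.\<close>

lemma count_partition_of_word:
  "count (partition_of_word d) (2 ^ j) = (if j < length d then digit d (length d - j) else 0)"
proof -
  have "count (partition_of_word d) (2 ^ j) =
      (\<Sum>i=1..length d. if j = length d - i then digit d i else 0)"
    by (simp add: partition_of_word_def count_sum)
  also have "\<dots> = (\<Sum>i=1..length d. if i = length d - j \<and> j < length d then digit d i else 0)"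
    by (intro sum.cong) auto
  also have "\<dots> = (if j < length d then digit d (length d - j) else 0)"
    by (auto simp: sum.delta)
  finally show ?thesis .
qed

lemma count_partition_of_word_not_power:
  "\<nexists>j. p = 2 ^ j \<Longrightarrow> count (partition_of_word d) p = 0"
  using partition_of_word_powers by (auto simp: count_eq_zero_iff)

text \<open>Guarantees that every power of two occurring in a partition of \<open>n\<close> has a
  position in a word of the prescribed length.\<close>

lemma less_power_length_binary_expansion: "n < 2 ^ length (binary_expansion n)"
proof (induction n rule: less_induct)
  case (less n)
  show ?case
  proof (cases "n = 0")
    case False
    then have "n div 2 < 2 ^ length (binary_expansion (n div 2))"
      using less by simp
    then show ?thesis
      using False binary_expansion.simps[of n] by simp
  qed simp
qed

lemma digit_mem:
  assumes "1 \<le> i" "i \<le> length d"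
  shows "digit d i \<in> set d"
  using assms by (simp add: digit_def)

lemma hyperbinary_expansion_digit:
  assumes "d \<in> hyperbinary_expansions n" "1 \<le> i" "i \<le> length (binary_expansion n)"
  shows "digit d i \<le> 2"
  using digit_mem[of i d] assms by (auto simp: hyperbinary_expansions_def)

lemma word_eqI:
  assumes "length d = length e" "\<And>i. 1 \<le> i \<Longrightarrow> i \<le> length d \<Longrightarrow> digit d i = digit e i"
  shows "d = e"
proof (rule nth_equalityI)
  fix i assume "i < length d"
  then show "d ! i = e ! i" using assms(2)[of "Suc i"] by (simp add: digit_def)
qed (fact assms(1))

lemma order_isomorphic_expansions_partitions:
  "order_isomorphic (hyperbinary_expansions n) expansion_le (hyperbinary_partitions n) refines"
proof -
  let ?k = "length (binary_expansion n)"
  have "inj_on partition_of_word (hyperbinary_expansions n)"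
  proof (rule inj_onI)
    fix d e assume d: "d \<in> hyperbinary_expansions n" and e: "e \<in> hyperbinary_expansions n"
      and eq: "partition_of_word d = partition_of_word e"
    have len: "length d = ?k" "length e = ?k"
      using d e by (auto simp: hyperbinary_expansions_def)
    show "d = e"
    proof (rule word_eqI)
      fix i assume i: "1 \<le> i" "i \<le> length d"
      then have "?k - i < ?k" "?k - (?k - i) = i"
        using len by auto
      then show "digit d i = digit e i"
        using count_partition_of_word[of d "?k - i"] count_partition_of_word[of e "?k - i"] eq len
        by simp
    qed (simp add: len)
  qed
  moreover have "partition_of_word d \<in> hyperbinary_partitions n"
    if d: "d \<in> hyperbinary_expansions n" for d
  proof -
    have "count (partition_of_word d) p \<le> 2" for p
    proof (cases "\<exists>j. p = 2 ^ j")
      case True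
      then obtain j where j: "p = 2 ^ j" ..
      have "digit d (length d - j) \<le> 2" if "j < length d"
        using hyperbinary_expansion_digit[of d n "length d - j"] d that
        by (simp add: hyperbinary_expansions_def)
      then show ?thesis by (auto simp: j count_partition_of_word)
    qed (simp add: count_partition_of_word_not_power)
    then show ?thesis
      using d by (auto simp: hyperbinary_partitions_def hyperbinary_expansions_def
          sum_mset_partition_of_word dest: partition_of_word_powers)
  qed
  moreover have "M \<in> partition_of_word ` hyperbinary_expansions n"
    if M: "M \<in> hyperbinary_partitions n" for M
  proof -
    define d where "d = map (\<lambda>i. count M (2 ^ (?k - Suc i))) [0..<?k]"
    have len: "length d = ?k" by (simp add: d_def)
    have "partition_of_word d = M"
    proof (rule multiset_eqI)
      fix p
      show "count (partition_of_word d) p = count M p"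
      proof (cases "\<exists>j. p = 2 ^ j")
        case True
        then obtain j where j: "p = 2 ^ j" ..
        have "count M p = 0" if "j \<ge> ?k"
        proof (rule ccontr)
          assume "count M p \<noteq> 0"
          then obtain N where "M = add_mset p N"
            by (metis count_eq_zero_iff mset_add)
          then have "p \<le> n"
            using M by (simp add: hyperbinary_partitions_def)
          moreover have "(2::nat) ^ ?k \<le> p"
            using that by (simp add: j)
          ultimately show False
            using less_power_length_binary_expansion[of n] by simp
        qed
        then show ?thesis
          by (auto simp: j count_partition_of_word len d_def digit_def Suc_diff_Suc)
      next
        case False
        then show ?thesis
          using M by (auto simp: count_partition_of_word_not_power hyperbinary_partitions_def
              count_eq_zero_iff)
      qed
    qed
    moreover have "d \<in> hyperbinary_expansions n"
    proof -
      have "count M p \<in> {0, 1, 2}" for p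
      proof -
        have "count M p \<le> 2" using M by (simp add: hyperbinary_partitions_def)
        then have "count M p = 0 \<or> count M p = 1 \<or> count M p = 2" by linarith
        then show ?thesis by simp
      qed
      then have "set d \<subseteq> {0, 1, 2}" unfolding d_def set_map by (intro image_subsetI)
      then show ?thesis
        using M \<open>partition_of_word d = M\<close> sum_mset_partition_of_word[of d]
        by (simp add: hyperbinary_expansions_def hyperbinary_partitions_def len)
    qed
    ultimately show ?thesis by blast
  qed
  ultimately have "bij_betw partition_of_word (hyperbinary_expansions n) (hyperbinary_partitions n)"
    by (auto simp: bij_betw_def)
  then show ?thesis
    unfolding order_isomorphic_def expansion_le_def by blast
qed

section \<open>Borrows and ideals of the fence\<close>

text \<open>Closure under single covers propagates along chains, so an ideal can be tested on covers
  alone.\<close>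

lemma lower_order_ideals_rtrancl:
  assumes "C \<subseteq> A \<times> A"
  shows "lower_order_ideals A (\<lambda>x y. (x, y) \<in> C\<^sup>*) =
    {I. I \<subseteq> A \<and> (\<forall>(x, y)\<in>C. y \<in> I \<longrightarrow> x \<in> I)}"
proof -
  have "x \<in> I" if "(x, y) \<in> C\<^sup>*" "y \<in> I" "\<forall>(x, y)\<in>C. y \<in> I \<longrightarrow> x \<in> I" for x y I
    using that by (induction rule: converse_rtrancl_induct) auto
  then show ?thesis
    using assms unfolding lower_order_ideals_def by blast
qed

lemma lower_order_ideals_fence:
  fixes n :: nat
  defines "r \<equiv> principal_prefix_length n" and "b \<equiv> binary_expansion n"
  shows "lower_order_ideals (fence_carrier n) (fence_le n) =
    {I. I \<subseteq> {1..r} \<and> (\<forall>i\<in>{2..r}. (digit b i = 0 \<longrightarrow> i - 1 \<in> I \<longrightarrow> i \<in> I) \<and>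
                              (digit b i = 1 \<longrightarrow> i \<in> I \<longrightarrow> i - 1 \<in> I))}"
proof -
  have "fence_covers n \<subseteq> fence_carrier n \<times> fence_carrier n"
    by (auto simp: fence_covers_def fence_carrier_def)
  moreover have "fence_le n = (\<lambda>x y. (x, y) \<in> (fence_covers n)\<^sup>*)"
    by (intro ext) (simp add: fence_le_def)
  ultimately show ?thesis
    using lower_order_ideals_rtrancl[of "fence_covers n" "fence_carrier n"]
    by (auto simp: fence_covers_def fence_carrier_def r_def b_def)
qed

section \<open>The binary digits around the last zero\<close>

lemma binary_expansion_digit:
  assumes "1 \<le> i" "i \<le> length (binary_expansion n)"
  shows "digit (binary_expansion n) i = 0 \<or> digit (binary_expansion n) i = 1"
  using digit_mem[OF assms] binary_expansion_correct(2)[of n] by auto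

lemma binary_expansion_digit_1:
  assumes "n \<ge> 1"
  shows "digit (binary_expansion n) 1 = 1" "1 \<le> length (binary_expansion n)"
  using binary_expansion_correct(3)[OF assms]
  by (auto simp: digit_def hd_conv_nth Suc_le_eq)

text \<open>The last claim needs \<open>r \<ge> 1\<close>: since the leading digit is 1,
  \<open>r = 0\<close> means that there is no zero at all.\<close>

lemma principal_prefix_length:
  fixes n :: nat
  assumes "n \<ge> 1"
  defines "r \<equiv> principal_prefix_length n" and "b \<equiv> binary_expansion n"
  shows "r < length b"
    and "\<And>i. r + 2 \<le> i \<Longrightarrow> i \<le> length b \<Longrightarrow> digit b i = 1"
    and "r \<ge> 1 \<Longrightarrow> digit b (Suc r) = 0"
proof -
  define Z where "Z = {j \<in> {1..length b}. digit b j = 0}"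
  have r: "r = (if Z = {} then 0 else Max Z - 1)"
    unfolding r_def principal_prefix_length_def b_def Z_def Let_def by (rule refl)
  have fin: "finite Z" by (simp add: Z_def)
  have b1: "digit b 1 = 1" "1 \<le> length b"
    using binary_expansion_digit_1[OF assms(1)] by (auto simp: b_def)
  have mx: "1 \<le> Max Z \<and> Max Z \<le> length b \<and> digit b (Max Z) = 0" if "Z \<noteq> {}"
    using Max_in[OF fin that] unfolding Z_def by simp
  show "r < length b"
    using r mx b1(2) by (cases "Z = {}") auto
  show "digit b i = 1" if "r + 2 \<le> i" "i \<le> length b" for i
  proof (rule ccontr)
    assume "digit b i \<noteq> 1"
    then have "i \<in> Z"
      using binary_expansion_digit[of i n] that by (auto simp: Z_def b_def)
    then have "i \<le> Max Z" "Z \<noteq> {}" using fin by auto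
    then show False using r that(1) by auto
  qed
  show "digit b (Suc r) = 0" if "r \<ge> 1"
    using r mx that by (cases "Z = {}") auto
qed

text \<open>Downward induction from the full length, where both values are \<open>n\<close>. From 2
  c_i = c_(i+1) + d_(i+1) - b_(i+1), the number 2 c_i lies between -1 and 3, so c_i is 0 or
  1.\<close>

lemma prefix_bounds:
  assumes d: "d \<in> hyperbinary_expansions n" and i: "i \<le> length (binary_expansion n)"
  shows "word_value (take i d) \<le> word_value (take i (binary_expansion n)) \<and>
    word_value (take i (binary_expansion n)) \<le> word_value (take i d) + 1"
  using i
proof (induction rule: inc_induct)
  case base
  then show ?case
    using d by (simp add: hyperbinary_expansions_def binary_expansion_correct(1))
next
  case (step i)
  have "length d = length (binary_expansion n)"
    using d by (simp add: hyperbinary_expansions_def)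
  then show ?case
    using step hyperbinary_expansion_digit[OF d, of "Suc i"] binary_expansion_digit[of "Suc i" n]
      word_value_take_Suc[of i d] word_value_take_Suc[of i "binary_expansion n"] by auto
qed

text \<open>Downward induction again: b_(i+1) = 1 and c_(i+1) = 0 give 2 c_i = d_(i+1) - 1, which is
  at most 1, so c_i = 0.\<close>

lemma prefix_eq_beyond_principal_prefix:
  assumes n: "n \<ge> 1" and d: "d \<in> hyperbinary_expansions n"
    and i: "i \<le> length (binary_expansion n)" "principal_prefix_length n < i"
  shows "word_value (take i d) = word_value (take i (binary_expansion n))"
  using i
proof (induction rule: inc_induct)
  case base
  then show ?case
    using d by (simp add: hyperbinary_expansions_def binary_expansion_correct(1))
next
  case (step i)
  have "length d = length (binary_expansion n)"
    using d by (simp add: hyperbinary_expansions_def)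
  then show ?case
    using step hyperbinary_expansion_digit[OF d, of "Suc i"]
      principal_prefix_length(2)[OF n, of "Suc i"] prefix_bounds[OF d, of i]
      word_value_take_Suc[of i d] word_value_take_Suc[of i "binary_expansion n"] by auto
qed

text \<open>Indices without a borrow are collected, not those with one, because a larger expansion
  has larger prefix values and hence fewer borrows; inclusion then runs in the direction of
  \<open>expansion_le\<close>.\<close>

definition no_borrow_set :: "nat \<Rightarrow> nat list \<Rightarrow> nat set" where
  "no_borrow_set n d = {i \<in> {1..principal_prefix_length n}.
     word_value (take i d) = word_value (take i (binary_expansion n))}"

text \<open>A violated closure condition would force the letter -1 (if b_i = 0) or 3 (if b_i =
  1).\<close>

lemma no_borrow_set_ideal:
  assumes n: "n \<ge> 1" and d: "d \<in> hyperbinary_expansions n"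
  shows "no_borrow_set n d \<in> lower_order_ideals (fence_carrier n) (fence_le n)"
proof -
  let ?b = "binary_expansion n"
  have len: "length d = length ?b"
    using d by (simp add: hyperbinary_expansions_def)
  have "(digit ?b i = 0 \<longrightarrow> i - 1 \<in> no_borrow_set n d \<longrightarrow> i \<in> no_borrow_set n d) \<and>
        (digit ?b i = 1 \<longrightarrow> i \<in> no_borrow_set n d \<longrightarrow> i - 1 \<in> no_borrow_set n d)"
    if i: "i \<in> {2..principal_prefix_length n}" for i
  proof -
    obtain l where l: "i = Suc l" "1 \<le> l" using i by (cases i) auto
    have "Suc l \<le> length ?b"
      using i l principal_prefix_length(1)[OF n] by auto
    then show ?thesis
      using i l len hyperbinary_expansion_digit[OF d, of "Suc l"]
        prefix_bounds[OF d, of l] prefix_bounds[OF d, of "Suc l"]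
        word_value_take_Suc[of l d] word_value_take_Suc[of l ?b]
      by (auto simp: no_borrow_set_def)
  qed
  then show ?thesis
    unfolding lower_order_ideals_fence by (auto simp: no_borrow_set_def)
qed

text \<open>Inside the principal prefix each value is that of \<open>?b\<close> or one less, so
  comparing values amounts to comparing membership; at all other indices the values agree.\<close>

lemma no_borrow_set_subset_iff:
  assumes n: "n \<ge> 1" and d: "d \<in> hyperbinary_expansions n" and e: "e \<in> hyperbinary_expansions n"
  shows "no_borrow_set n d \<subseteq> no_borrow_set n e \<longleftrightarrow>
    (\<forall>i\<le>length d. word_value (take i d) \<le> word_value (take i e))"
proof -
  let ?b = "binary_expansion n"
  let ?r = "principal_prefix_length n"
  have len: "length d = length ?b"
    using d by (simp add: hyperbinary_expansions_def)
  have r: "?r < length ?b" using principal_prefix_length(1)[OF n] .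
  have "(i \<in> no_borrow_set n d \<longrightarrow> i \<in> no_borrow_set n e) \<longleftrightarrow>
      word_value (take i d) \<le> word_value (take i e)" if "i \<in> {1..?r}" for i
    using that r prefix_bounds[OF d, of i] prefix_bounds[OF e, of i]
    by (auto simp: no_borrow_set_def)
  moreover have "word_value (take i d) = word_value (take i e)"
    if "i \<le> length ?b" "i \<notin> {1..?r}" for i
  proof (cases "i = 0")
    case False
    then show ?thesis
      using that prefix_eq_beyond_principal_prefix[OF n d, of i]
        prefix_eq_beyond_principal_prefix[OF n e, of i] by simp
  qed simp
  moreover have "no_borrow_set n d \<subseteq> {1..?r}" by (auto simp: no_borrow_set_def)
  ultimately show ?thesis
    using len r unfolding subset_iff
    by (metis atLeastAtMost_iff le_refl less_imp_le_nat order_trans)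
qed

lemma ideal_is_no_borrow_set:
  assumes n: "n \<ge> 1" and I: "I \<in> lower_order_ideals (fence_carrier n) (fence_le n)"
  shows "\<exists>d\<in>hyperbinary_expansions n. no_borrow_set n d = I"
proof -
  let ?b = "binary_expansion n"
  let ?k = "length ?b"
  let ?r = "principal_prefix_length n"
  have Isub: "I \<subseteq> {1..?r}"
    and I0: "\<And>i. i \<in> {2..?r} \<Longrightarrow> digit ?b i = 0 \<Longrightarrow> i - 1 \<in> I \<Longrightarrow> i \<in> I"
    and I1: "\<And>i. i \<in> {2..?r} \<Longrightarrow> digit ?b i = 1 \<Longrightarrow> i \<in> I \<Longrightarrow> i - 1 \<in> I"
    using I unfolding lower_order_ideals_fence by auto
  \<comment> \<open>The prescribed borrows: 1 exactly on the complement of \<open>I\<close> in the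
    fence, hence 0 at index 0 and beyond the prefix. The recurrence for the letters then dictates
    \<open>d\<close>.\<close>
  define c :: "nat \<Rightarrow> nat" where "c i = (if i \<in> {1..?r} - I then 1 else 0)" for i
  define d where "d = map (\<lambda>i. digit ?b (Suc i) + 2 * c i - c (Suc i)) [0..<?k]"
  have len: "length d = ?k" by (simp add: d_def)
  have dig: "digit d (Suc i) = digit ?b (Suc i) + 2 * c i - c (Suc i)" if "i < ?k" for i
    using that by (simp add: d_def digit_def)
  have c: "c i \<le> 1" for i by (simp add: c_def)
  have ck: "c ?k = 0" using principal_prefix_length(1)[OF n] by (simp add: c_def)
  \<comment> \<open>The letters are neither truncated at 0 nor larger than 2.\<close>
  have bounds: "c (Suc i) \<le> digit ?b (Suc i) + 2 * c i \<and>
      digit ?b (Suc i) + 2 * c i \<le> 2 + c (Suc i)" if i: "i < ?k" for i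
  proof -
    have b: "digit ?b (Suc i) = 0 \<or> digit ?b (Suc i) = 1"
      using binary_expansion_digit[of "Suc i" n] i by simp
    \<comment> \<open>The ideal conditions settle the interior of the prefix. At its left end the
      leading 1 covers a possible borrow; at its right end the digit 0 leaves room for the letter
      \<open>2 * c i\<close>.\<close>
    consider "i = 0" | "1 \<le> i" "i < ?r" | "1 \<le> i" "i = ?r" | "?r < i"
      by linarith
    then show ?thesis
    proof cases
      case 1
      then show ?thesis
        using binary_expansion_digit_1[OF n] by (simp add: c_def)
    next
      case 2
      then show ?thesis
        using b I0[of "Suc i"] I1[of "Suc i"] by (auto simp: c_def)
    next
      case 3
      then show ?thesis
        using principal_prefix_length(3)[OF n] by (simp add: c_def)
    next
      case 4
      then show ?thesis
        using b by (auto simp: c_def)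
    qed
  qed
  have val: "word_value (take i d) + c i = word_value (take i ?b)" if "i \<le> ?k" for i
    using that
  proof (induction i)
    case 0
    then show ?case by (simp add: c_def)
  next
    case (Suc i)
    then show ?case
      using word_value_take_Suc[of i d] word_value_take_Suc[of i ?b] dig[of i] bounds[of i] len
      by auto
  qed
  have "set d \<subseteq> {0, 1, 2}"
  proof
    fix x assume "x \<in> set d"
    then obtain i where i: "i < ?k" "x = digit ?b (Suc i) + 2 * c i - c (Suc i)"
      by (auto simp: d_def)
    then show "x \<in> {0, 1, 2}" using bounds[of i] by auto
  qed
  then have "d \<in> hyperbinary_expansions n"
    using val[of ?k] len ck binary_expansion_correct(1)[of n]
    by (simp add: hyperbinary_expansions_def)
  moreover have "no_borrow_set n d = I"
  proof -
    have "word_value (take i d) = word_value (take i ?b) \<longleftrightarrow> i \<in> I" if "i \<in> {1..?r}" for i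
    proof -
      have "word_value (take i d) + c i = word_value (take i ?b)"
        using that principal_prefix_length(1)[OF n] by (intro val) auto
      then have "word_value (take i d) = word_value (take i ?b) \<longleftrightarrow> c i = 0" by linarith
      then show ?thesis using that by (simp add: c_def)
    qed
    then show ?thesis using Isub by (auto simp: no_borrow_set_def)
  qed
  ultimately show ?thesis by blast
qed

lemma order_isomorphic_expansions_ideals:
  assumes n: "n \<ge> 1"
  shows "order_isomorphic (hyperbinary_expansions n) expansion_le
    (lower_order_ideals (fence_carrier n) (fence_le n)) (\<subseteq>)"
proof -
  let ?H = "hyperbinary_expansions n"
  have "inj_on (no_borrow_set n) ?H"
  proof (rule inj_onI)
    fix d e assume d: "d \<in> ?H" and e: "e \<in> ?H" and eq: "no_borrow_set n d = no_borrow_set n e"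
    have len: "length d = length e"
      using d e by (simp add: hyperbinary_expansions_def)
    have V: "word_value (take i d) = word_value (take i e)" if "i \<le> length d" for i
      using no_borrow_set_subset_iff[OF n d e] no_borrow_set_subset_iff[OF n e d] eq len that
      by (simp add: order_antisym)
    show "d = e"
    \<comment> \<open>Each letter is the value of the prefix ending there minus twice the preceding
      prefix value.\<close>
    proof (rule word_eqI)
      fix i assume i: "1 \<le> i" "i \<le> length d"
      then obtain l where "i = Suc l" by (cases i) auto
      then show "digit d i = digit e i"
        using word_value_take_Suc[of l d] word_value_take_Suc[of l e] V[of i] V[of l] i len by simp
    qed (fact len)
  qed
  then have "bij_betw (no_borrow_set n) ?H (lower_order_ideals (fence_carrier n) (fence_le n))"
    using no_borrow_set_ideal[OF n] ideal_is_no_borrow_set[OF n] by (force simp: bij_betw_def)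
  moreover have "expansion_le d e \<longleftrightarrow> no_borrow_set n d \<subseteq> no_borrow_set n e"
    if "d \<in> ?H" "e \<in> ?H" for d e
    using that no_borrow_set_subset_iff[OF n that] expansion_le_iff[of d e]
    by (simp add: hyperbinary_expansions_def)
  ultimately show ?thesis
    unfolding order_isomorphic_def by blast
qed

theorem theorem3p16:
  fixes n :: nat
  assumes "n \<ge> 1"
  shows "order_isomorphic
           (hyperbinary_expansions n) expansion_le
           (lower_order_ideals (fence_carrier n) (fence_le n)) (\<subseteq>) \<and>
         order_isomorphic
           (hyperbinary_partitions n) refines
           (lower_order_ideals (fence_carrier n) (fence_le n)) (\<subseteq>)"
  using order_isomorphic_expansions_ideals[OF assms]
    order_isomorphic_trans[OF order_isomorphic_sym[OF order_isomorphic_expansions_partitions]]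
  by blast

end
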